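(* Let $n,m$ be positive integers with $1\le n\le 2^{m-1}-1$. Then $$g(n,m) > \frac{n(m+1)}{\log_2(n+1)+2}.$$ In particular $g(n,m)=\Omega\!\left(\frac{nm}{\log_2 n}\right)$.
   Context: Write $[m]=\{1,\ldots,m\}$. For a multiset $\mathcal{F}=\{C_1,\ldots,C_k\}$ of non-empty subsets of $[m]$ (repetitions allowed; members indexed by $[k]$), a resolution into $n$ classes is a partition $\{A_1,\ldots,A_n\}$ of $[k]$ into $n$ blocks such that for each $i$ the sets $C_j$, $j\in A_i$, are pairwise disjoint with union $[m]$. $\mathcal{F}$ is uniquely resolvable with respect to $(n,m)$ if it has exactly one resolution into $n$ classes (partitions regarded as unordered). $g(n,m)$ is the maximum size $k$ of a uniquely resolvable multiset with respect to $(n,m)$. *)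

theory Defs
  imports Complex_Main "HOL-Library.Disjoint_Sets" "HOL-Library.Landau_Symbols"
begin

text \<open>A multiset of size \<open>k\<close> is given by the family \<open>C 1, \<dots>, C k\<close>; the values of \<open>C\<close> outside
  \<open>{1..k}\<close> play no role. A resolution is a partition of the index set, so exchanging two equal
  members that lie in different classes in general yields a different resolution.\<close>

definition resolution :: "nat \<Rightarrow> nat \<Rightarrow> nat \<Rightarrow> (nat \<Rightarrow> nat set) \<Rightarrow> nat set set \<Rightarrow> bool" where
  "resolution n m k C P \<longleftrightarrow>
     partition_on {1..k} P \<and> card P = n \<and>
     (\<forall>A\<in>P. disjoint_family_on C A \<and> (\<Union>j\<in>A. C j) = {1..m})"

definition uniquely_resolvable :: "nat \<Rightarrow> nat \<Rightarrow> nat \<Rightarrow> (nat \<Rightarrow> nat set) \<Rightarrow> bool" where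
  "uniquely_resolvable n m k C \<longleftrightarrow>
     (\<forall>j\<in>{1..k}. C j \<noteq> {} \<and> C j \<subseteq> {1..m}) \<and> (\<exists>!P. resolution n m k C P)"

text \<open>The paper's \<open>g(n,m)\<close>. It is shown below that the maximum is taken over a finite
  set, which is non-empty for positive \<open>m\<close>.\<close>

definition max_unique_size :: "nat \<Rightarrow> nat \<Rightarrow> nat" where
  "max_unique_size n m = Max {k. \<exists>C. uniquely_resolvable n m k C}"

lemma finite_uniquely_resolvable_sizes: "finite {k. \<exists>C. uniquely_resolvable n m k C}"
proof (rule finite_subset)
  show "{k. \<exists>C. uniquely_resolvable n m k C} \<subseteq> {..n * m}"
  proof
    fix k assume "k \<in> {k. \<exists>C. uniquely_resolvable n m k C}"
    then obtain C where "uniquely_resolvable n m k C" by blast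
    then obtain P where P: "partition_on {1..k} P" "card P = n"
      and R: "\<And>A. A \<in> P \<Longrightarrow> disjoint_family_on C A \<and> (\<Union>j\<in>A. C j) = {1..m}"
      and ne: "\<And>j. j \<in> {1..k} \<Longrightarrow> C j \<noteq> {} \<and> C j \<subseteq> {1..m}"
      by (auto simp: uniquely_resolvable_def resolution_def dest!: ex1_implies_ex)
    have sub: "A \<subseteq> {1..k}" if "A \<in> P" for A
      using that P(1) by (auto simp: partition_on_def)
    have fin: "finite A" if "A \<in> P" for A
      using sub[OF that] by (rule finite_subset) simp
    have finC: "finite (C j)" if "j \<in> {1..k}" for j
      using ne[OF that] finite_subset[of "C j" "{1..m}"] by blast
    have "card A \<le> m" if A: "A \<in> P" for A
    proof -
      have "card A = (\<Sum>j\<in>A. 1)" by simp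
      also have "\<dots> \<le> (\<Sum>j\<in>A. card (C j))"
      proof (rule sum_mono)
        fix j assume "j \<in> A"
        then have "C j \<noteq> {}" "finite (C j)"
          using ne[of j] finC[of j] sub[OF A] by blast+
        then show "1 \<le> card (C j)" by (simp add: Suc_leI card_gt_0_iff)
      qed
      also have "\<dots> = card (\<Union>j\<in>A. C j)"
      proof (rule card_UN_disjoint[symmetric])
        show "finite A" by (rule fin[OF A])
        show "\<forall>i\<in>A. finite (C i)" using finC sub[OF A] by blast
        show "\<forall>i\<in>A. \<forall>j\<in>A. i \<noteq> j \<longrightarrow> C i \<inter> C j = {}"
          using R[OF A] by (simp add: disjoint_family_on_def)
      qed
      also have "\<dots> = m" using R[OF A] by simp
      finally show ?thesis .
    qed
    then have "(\<Sum>A\<in>P. card A) \<le> n * m"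
      using sum_bounded_above[of P card m] P(2) by simp
    moreover have "card (\<Union>P) \<le> (\<Sum>A\<in>P. card A)"
      by (rule card_Union_le_sum_card)
    moreover have "\<Union>P = {1..k}" using P(1) by (simp add: partition_on_def)
    ultimately show "k \<in> {..n * m}" by simp
  qed
qed simp

lemma singleton_cover:
  assumes s: "\<And>A. A \<in> P \<Longrightarrow> \<exists>j. A = {j}" and u: "\<Union>P = X"
  shows "P = (\<lambda>j. {j}) ` X"
proof
  show "P \<subseteq> (\<lambda>j. {j}) ` X"
  proof
    fix A assume A: "A \<in> P"
    then obtain j where "A = {j}" using s by blast
    with A u show "A \<in> (\<lambda>j. {j}) ` X" by blast
  qed
  show "(\<lambda>j. {j}) ` X \<subseteq> P"
  proof clarify
    fix j assume "j \<in> X"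
    then obtain A where A: "A \<in> P" "j \<in> A" using u by blast
    then obtain i where "A = {i}" using s by blast
    with A show "{j} \<in> P" by simp
  qed
qed

lemma uniquely_resolvable_sizes_nonempty:
  assumes "m \<ge> 1"
  shows "{k. \<exists>C. uniquely_resolvable n m k C} \<noteq> {}"
proof -
  let ?S = "(\<lambda>j. {j}) ` {1..n}"
  have "resolution n m n (\<lambda>_. {1..m}) ?S"
    by (auto simp: resolution_def partition_on_def disjoint_def disjoint_family_on_def card_image)
  moreover have "P = ?S" if "resolution n m n (\<lambda>_. {1..m}) P" for P
  proof -
    have P: "partition_on {1..n} P"
      and dj: "\<And>A. A \<in> P \<Longrightarrow> disjoint_family_on (\<lambda>_. {1..m}) A"
      using that by (auto simp: resolution_def)
    have "\<exists>j. A = {j}" if A: "A \<in> P" for A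
    proof -
      obtain j where j: "j \<in> A" using P A unfolding partition_on_def by (cases "A = {}") blast+
      moreover have "i = j" if "i \<in> A" for i
        using dj[OF A] that j assms by (auto simp: disjoint_family_on_def)
      ultimately show ?thesis by blast
    qed
    moreover have "\<Union>P = {1..n}" using P by (simp add: partition_on_def)
    ultimately show ?thesis by (intro singleton_cover)
  qed
  ultimately have "uniquely_resolvable n m n (\<lambda>_. {1..m})"
    using assms by (auto simp: uniquely_resolvable_def)
  then show ?thesis by blast
qed

end

theory Submission
  imports Defs
begin

text \<open>Cut \<open>{1..m}\<close> into \<open>t\<close> consecutive blocks of length at least \<open>s\<close>, where \<open>2 ^ (s - 1) > n\<close>,
  and choose distinct subsets \<open>X\<^sub>i\<close> (\<open>i < n\<close>) of a block, each containing the first element of the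
  block but not the whole block. Class \<open>i\<close> consists of \<open>t + 1\<close> sets: the set of type \<open>p\<close> is the
  copy of \<open>X\<^sub>i\<close> in block \<open>p\<close> together with the copy of the complement of \<open>X\<^sub>i\<close> in block \<open>p - 1\<close>.
  The first elements of the blocks force every class of a resolution to contain exactly one set
  of each type, and then consecutive types must have the same \<open>i\<close> because they have to fill a block
  exactly. Choosing \<open>s\<close> minimal gives \<open>s < log 2 (n + 1) + 2\<close>, and the size is
  \<open>n * (t + 1) \<ge> n * (m + 1) / s\<close> with \<open>t = m div s\<close>.\<close>

text \<open>Pigeonhole: disjoint blocks pick distinct elements of \<open>T\<close>, and
  \<open>T\<close> has at most as many elements as there are blocks. So the picks exhaust
  \<open>T\<close>, and a second element of \<open>T\<close> in a block would be the pick of another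
  block. Below, \<open>T\<close> consists of the indices of one type.\<close>

lemma partition_on_transversal:
  assumes P: "partition_on X P" and "finite X" "T \<subseteq> X" "card T \<le> card P"
    and meets: "\<And>A. A \<in> P \<Longrightarrow> A \<inter> T \<noteq> {}"
    and A: "A \<in> P" "x \<in> A \<inter> T" "y \<in> A \<inter> T"
  shows "x = y"
proof -
  define f where "f B = (SOME z. z \<in> B \<inter> T)" for B
  have f: "f B \<in> B \<inter> T" if "B \<in> P" for B
    unfolding f_def by (rule someI_ex) (use meets[OF that] in blast)
  have same: "B = B'" if "B \<in> P" "B' \<in> P" "z \<in> B" "z \<in> B'" for B B' z
    using P that by (auto simp: partition_on_def disjoint_def)
  have "inj_on f P"
    by (rule inj_onI) (metis IntD1 f same)
  moreover have "f ` P \<subseteq> T" using f by blast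
  moreover have "finite T" using assms(2,3) finite_subset by blast
  ultimately have "f ` P = T"
    by (metis card_image card_subset_eq card_mono le_antisym assms(4))
  then obtain B B' where "B \<in> P" "x = f B" "B' \<in> P" "y = f B'"
    using A by blast
  then show ?thesis using A f same by (metis IntD1)
qed

lemma uniquely_resolvable_blocks:
  fixes n m s :: nat
  assumes s: "n \<le> 2 ^ (s - 1) - 1" "1 \<le> n" "s \<le> m"
  shows "\<exists>C. uniquely_resolvable n m (n * (m div s + 1)) C"
proof -
  define t where "t = m div s"
  define k where "k = n * (t + 1)"
  have s1: "s > 1"
  proof (rule ccontr)
    assume "\<not> s > 1"
    then have "s - 1 = 0" by simp
    with s show False by simp
  qed
  have t1: "t \<ge> 1" using s s1 by (simp add: t_def Suc_le_eq div_greater_zero_iff)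
  have st: "s * t \<le> m" by (simp add: t_def)
  \<comment> \<open>Offset 0, the first element of a block, is always chosen, so only a proper
    subset \<open>F i\<close> of the remaining offsets \<open>{1..<s}\<close> has to be
    encoded.\<close>
  have "card (Pow {1..<s} - {{1..<s}}) = 2 ^ (s - 1) - 1"
    by (simp add: card_Pow)
  then obtain F where F: "F ` {..<n} \<subseteq> Pow {1..<s} - {{1..<s}}" "inj_on F {..<n}"
    using card_le_inj[of "{..<n}" "Pow {1..<s} - {{1..<s}}"] s(1) by auto
  \<comment> \<open>The \<open>min\<close> attaches the points beyond \<open>s * t\<close> to the
    last block. Their offsets are at least \<open>s\<close>, hence outside every \<open>F i\<close>
    with \<open>i < n\<close>, and they get type \<open>t\<close>.\<close>
  define blk where "blk x = min ((x - 1) div s) (t - 1)" for x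
  define ty where "ty j = (j - 1) div n" for j
  define cls where "cls j = (j - 1) mod n" for j
  \<comment> \<open>The type of the member of class \<open>i\<close> that contains \<open>x\<close>.
    The members of a class are thus the fibres of a function, hence disjoint and covering.\<close>
  define typ_of where "typ_of i x =
    blk x + (if x - 1 - s * blk x = 0 \<or> x - 1 - s * blk x \<in> F i then 0 else 1)" for i x
  define C where "C j = {x \<in> {1..m}. typ_of (cls j) x = ty j}" for j
  \<comment> \<open>Division of \<open>j - 1\<close> by \<open>n\<close> with remainder:
    \<open>idx\<close> inverts the pair \<open>cls\<close>, \<open>ty\<close> on
    \<open>{1..k}\<close>.\<close>
  define idx where "idx i p = n * p + i + 1" for i p
  define K where "K i = idx i ` {..t}" for i
  have blk: "blk (s * p + o' + 1) = p" if "p < t" "o' < s" for p o'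
    using that by (simp add: blk_def)
  have typ_of: "typ_of i (s * p + o' + 1) = p + (if o' = 0 \<or> o' \<in> F i then 0 else 1)"
    if "p < t" "o' < s" for i p o'
    using blk[OF that] by (simp add: typ_of_def)
  have in_m: "s * p + o' + 1 \<in> {1..m}" if "p < t" "o' < s" for p o'
  proof -
    have "s * p + o' + 1 \<le> s * (p + 1)" using that by simp
    also have "\<dots> \<le> s * t" using that by (intro mult_le_mono) auto
    finally show ?thesis using st by simp
  qed
  have typ_le: "typ_of i x \<le> t" for i x
    using t1 by (auto simp: typ_of_def blk_def)
  have idx: "idx i p \<in> {1..k}" "ty (idx i p) = p" "cls (idx i p) = i" if "i < n" "p \<le> t" for i p
  proof -
    have "n * p + i + 1 \<le> n * (p + 1)" using that by simp
    also have "\<dots> \<le> n * (t + 1)" using that by (intro mult_le_mono) auto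
    finally show "idx i p \<in> {1..k}" by (simp add: idx_def k_def)
    show "ty (idx i p) = p" "cls (idx i p) = i"
      using that by (simp_all add: idx_def ty_def cls_def)
  qed
  have idx_inv: "idx (cls j) (ty j) = j" "cls j < n" "ty j \<le> t" if "j \<in> {1..k}" for j
  proof -
    show "idx (cls j) (ty j) = j" "cls j < n"
      using that s(2) by (simp_all add: idx_def ty_def cls_def)
    have "j - 1 < (t + 1) * n" using that by (auto simp: k_def mult.commute)
    then show "ty j \<le> t" unfolding ty_def
      by (metis Suc_eq_plus1 less_Suc_eq_le less_mult_imp_div_less)
  qed
  \<comment> \<open>In the last block such an offset makes the sets of type \<open>t\<close>
    non-empty, and later forces type \<open>t\<close> to occur in every class.\<close>
  have gap: "\<exists>o'\<in>{1..<s}. o' \<notin> F i" if "i < n" for i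
    using F(1) that by (auto simp: image_subset_iff)
  have nonempty: "C j \<noteq> {}" if j: "j \<in> {1..k}" for j
  proof (cases "ty j < t")
    case True
    then have "s * ty j + 0 + 1 \<in> C j"
      using typ_of[of "ty j" 0 "cls j"] in_m[of "ty j" 0] s1 by (simp add: C_def)
    then show ?thesis by blast
  next
    case False
    obtain o' where o': "o' \<in> {1..<s}" "o' \<notin> F (cls j)" using gap idx_inv(2)[OF j] by blast
    then have "s * (t - 1) + o' + 1 \<in> C j"
      using typ_of[of "t - 1" o' "cls j"] in_m[of "t - 1" o'] t1 False idx_inv(3)[OF j]
      by (simp add: C_def)
    then show ?thesis by blast
  qed

  \<comment> \<open>The intended resolution into the classes \<open>K i\<close>\<close>
  have K_sub: "K i \<subseteq> {1..k}" if "i < n" for i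
    using idx(1)[OF that] by (auto simp: K_def)
  have K_cls: "cls j = i" if "i < n" "j \<in> K i" for i j
    using that idx(3) by (auto simp: K_def)
  have K_mem: "j \<in> K (cls j)" if "j \<in> {1..k}" for j
    unfolding K_def by (rule image_eqI[of _ _ "ty j"]) (use idx_inv[OF that] in auto)
  have K_ne: "K i \<noteq> {}" for i by (auto simp: K_def)
  have K_inj: "inj_on K {..<n}"
    by (rule inj_onI) (metis K_cls K_ne ex_in_conv lessThan_iff)
  have card_K: "card (K ` {..<n}) = n"
    using K_inj by (simp add: card_image)
  have res: "resolution n m k C (K ` {..<n})"
    unfolding resolution_def
  proof (intro conjI ballI)
    show "partition_on {1..k} (K ` {..<n})"
    proof (rule partition_onI)
      show "\<Union> (K ` {..<n}) = {1..k}"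
      proof (rule equalityI)
        show "{1..k} \<subseteq> \<Union> (K ` {..<n})"
          using K_mem idx_inv(2) by (meson UN_I lessThan_iff subsetI)
      qed (use K_sub in auto)
      show "disjnt A B" if "A \<in> K ` {..<n}" "B \<in> K ` {..<n}" "A \<noteq> B" for A B
      proof -
        obtain i j where "A = K i" "B = K j" "i < n" "j < n" "i \<noteq> j"
          using \<open>A \<in> _\<close> \<open>B \<in> _\<close> \<open>A \<noteq> B\<close> by auto
        then show ?thesis using K_cls by (metis disjnt_iff)
      qed
    qed (use K_ne in auto)
    show "card (K ` {..<n}) = n" by (rule card_K)
  next
    fix A assume "A \<in> K ` {..<n}"
    then obtain i where i: "i < n" "A = K i" by blast
    show "disjoint_family_on C A"
      unfolding disjoint_family_on_def i(2) K_def
      using idx(2,3)[OF i(1)] by (auto simp: C_def)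
    show "(\<Union>j\<in>A. C j) = {1..m}"
    proof
      show "{1..m} \<subseteq> (\<Union>j\<in>A. C j)"
      proof
        fix x assume x: "x \<in> {1..m}"
        have "x \<in> C (idx i (typ_of i x))"
          using x idx(2,3)[OF i(1) typ_le] by (simp add: C_def)
        then show "x \<in> (\<Union>j\<in>A. C j)" using typ_le by (auto simp: i(2) K_def)
      qed
    qed (auto simp: C_def)
  qed

  \<comment> \<open>Uniqueness of the resolution\<close>
  have uniq: "P = K ` {..<n}" if "resolution n m k C P" for P
  proof -
    have P: "partition_on {1..k} P" and cardP: "card P = n"
      and dj: "\<And>A. A \<in> P \<Longrightarrow> disjoint_family_on C A"
      and cov: "\<And>A. A \<in> P \<Longrightarrow> (\<Union>j\<in>A. C j) = {1..m}"
      using that by (auto simp: resolution_def)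
    have sub: "A \<subseteq> {1..k}" if "A \<in> P" for A
      using P that by (auto simp: partition_on_def)
    have mem: "j \<in> {1..k}" if "A \<in> P" "j \<in> A" for A j
      using sub that by blast
    \<comment> \<open>A type has at most \<open>n\<close> indices, one per value of
      \<open>cls\<close>, while \<open>P\<close> has \<open>n\<close> blocks. So a type that meets
      every block meets each of them only once.\<close>
    have unique_typ: "j = j'"
      if meets: "\<And>A. A \<in> P \<Longrightarrow> \<exists>j\<in>A. ty j = p"
        and A: "A \<in> P" "j \<in> A" "j' \<in> A" "ty j = p" "ty j' = p" for A j j' p
    proof (rule partition_on_transversal[OF P])
      let ?T = "{j \<in> {1..k}. ty j = p}"
      have "?T \<subseteq> (\<lambda>i. idx i p) ` {..<n}"
      proof
        fix l assume "l \<in> ?T"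
        then show "l \<in> (\<lambda>i. idx i p) ` {..<n}"
          using idx_inv(1,2)[of l] by (intro image_eqI[of _ _ "cls l"]) auto
      qed
      then have "card ?T \<le> card {..<n}"
        by (meson card_image_le card_mono finite_imageI finite_lessThan le_trans)
      then show "card ?T \<le> card P" by (simp add: cardP)
      show "A \<inter> ?T \<noteq> {}" if "A \<in> P" for A
        using meets[OF that] sub[OF that] by blast
    qed (use A sub[OF A(1)] in \<open>simp_all add: subset_eq\<close>)
    have covered: "\<exists>j\<in>A. x \<in> C j" if "A \<in> P" "x \<in> {1..m}" for A x
      using cov[OF that(1)] that(2) by blast
    \<comment> \<open>The first element of block \<open>p\<close> lies only in sets of type
      \<open>p\<close>.\<close>
    have low: "\<exists>j\<in>A. ty j = p" if A: "A \<in> P" and p: "p < t" for A p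
    proof -
      obtain j where "j \<in> A" "s * p + 0 + 1 \<in> C j"
        using covered[OF A in_m[of p 0]] p s1 by auto
      then show ?thesis using typ_of[of p 0] p s1 by (auto simp: C_def)
    qed
    \<comment> \<open>The only member of type \<open>t - 1\<close> misses a point of the last block.
      Whatever covers that point has type \<open>t - 1\<close> or \<open>t\<close>, hence
      \<open>t\<close>.\<close>
    have top: "\<exists>j\<in>A. ty j = t" if A: "A \<in> P" for A
    proof -
      obtain j where j: "j \<in> A" "ty j = t - 1" using low[OF A, of "t - 1"] t1 by auto
      obtain o' where o': "o' \<in> {1..<s}" "o' \<notin> F (cls j)"
        using gap idx_inv(2) sub[OF A] j by blast
      let ?x = "s * (t - 1) + o' + 1"
      obtain j' where j': "j' \<in> A" "?x \<in> C j'"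
        using covered[OF A in_m[of "t - 1" o']] o' t1 by auto
      have ty: "typ_of i ?x = t - 1 + (if o' = 0 \<or> o' \<in> F i then 0 else 1)" for i
        using typ_of[of "t - 1" o' i] o' t1 by auto
      have "j' \<noteq> j" using j' ty[of "cls j"] o' j by (auto simp: C_def)
      then have "ty j' \<noteq> t - 1"
        using unique_typ[of "t - 1" A j j'] low t1 A j j'(1) by auto
      then have "ty j' = t"
        using j'(2) ty[of "cls j'"] t1 by (auto simp: C_def split: if_splits)
      then show ?thesis using j'(1) by blast
    qed
    have every_typ: "\<exists>j\<in>A. ty j = p" if "A \<in> P" "p \<le> t" for A p
      using low top that by (cases "p = t") auto
    have inj: "j = j'" if "A \<in> P" "j \<in> A" "j' \<in> A" "ty j = ty j'" for A j j'
    proof (rule unique_typ[OF _ that(1-3)])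
      show "\<exists>l\<in>B. ty l = ty j" if "B \<in> P" for B
        using every_typ[OF that] idx_inv(3)[OF mem] \<open>A \<in> P\<close> \<open>j \<in> A\<close> by simp
    qed (use that in simp_all)
    \<comment> \<open>Within block \<open>ty j\<close> only \<open>j\<close> and \<open>j'\<close>
      can cover a point, and they are disjoint. So what \<open>j'\<close> contributes is exactly the
      complement of what \<open>j\<close> contributes, which gives equal sets \<open>F\<close> and,
      by injectivity, equal \<open>cls\<close>.\<close>
    have step: "cls j = cls j'"
      if A: "A \<in> P" and j: "j \<in> A" "j' \<in> A" "ty j' = ty j + 1" for A j j'
    proof -
      have lt: "ty j < t" using idx_inv(3)[OF mem[OF A j(2)]] j(3) by simp
      have n: "cls j < n" "cls j' < n" using idx_inv(2)[OF mem[OF A]] j by simp_all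
      have "o' \<in> F (cls j) \<longleftrightarrow> o' \<in> F (cls j')" if o': "o' \<in> {1..<s}" for o'
      proof -
        let ?x = "s * ty j + o' + 1"
        have ty: "typ_of i ?x = ty j + (if o' \<in> F i then 0 else 1)" for i
          using typ_of[of "ty j" o' i] o' lt by simp
        have x: "?x \<in> {1..m}" using in_m[of "ty j" o'] lt o' by simp
        obtain l where l: "l \<in> A" "?x \<in> C l" using covered[OF A x] by blast
        then have "ty l = ty j \<or> ty l = ty j'"
          using ty[of "cls l"] j(3) by (auto simp: C_def split: if_splits)
        then have "l = j \<or> l = j'" using inj[OF A] l(1) j by metis
        moreover have "C j \<inter> C j' = {}"
          using dj[OF A] j unfolding disjoint_family_on_def by force
        moreover have "?x \<in> C j \<longleftrightarrow> o' \<in> F (cls j)"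
          using ty[of "cls j"] x by (auto simp: C_def)
        moreover have "?x \<in> C j' \<longleftrightarrow> o' \<notin> F (cls j')"
          using ty[of "cls j'"] x j(3) by (auto simp: C_def)
        ultimately show ?thesis using l(2) by blast
      qed
      moreover have "F (cls j) \<subseteq> {1..<s}" "F (cls j') \<subseteq> {1..<s}" using F(1) n by auto
      ultimately have "F (cls j) = F (cls j')" by blast
      then show ?thesis using F(2) n by (auto simp: inj_on_def)
    qed
    have "A \<in> K ` {..<n}" if A: "A \<in> P" for A
    proof -
      obtain a where a: "a \<in> A" "ty a = 0" using low[OF A, of 0] t1 by auto
      \<comment> \<open>Induction on the type carries \<open>cls\<close> from the member of type 0
        to all of \<open>A\<close>.\<close>
      have cls: "j \<in> A \<Longrightarrow> ty j = p \<Longrightarrow> cls j = cls a" for j p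
      proof (induction p arbitrary: j)
        case 0
        then show ?case using inj[OF A] a by metis
      next
        case (Suc p)
        have "Suc p \<le> t" using idx_inv(3)[OF mem[OF A]] Suc.prems by metis
        then obtain j' where "j' \<in> A" "ty j' = p" using low[OF A, of p] by auto
        then show ?case using Suc step[OF A, of j' j] by simp
      qed
      have "A = K (cls a)"
      proof
        show "A \<subseteq> K (cls a)" using K_mem[OF mem[OF A]] cls by (metis subsetI)
        show "K (cls a) \<subseteq> A"
        proof
          fix j assume "j \<in> K (cls a)"
          then obtain p where p: "p \<le> t" "j = idx (cls a) p" by (auto simp: K_def)
          obtain j' where j': "j' \<in> A" "ty j' = p" using every_typ[OF A p(1)] by blast
          then have "j' = j" using idx_inv(1)[OF mem[OF A j'(1)]] cls[OF j'] j'(2) p(2) by simp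
          then show "j \<in> A" using j' by simp
        qed
      qed
      then show ?thesis using idx_inv(2)[OF mem[OF A a(1)]] by simp
    qed
    then have "P \<subseteq> K ` {..<n}" by blast
    then show ?thesis using cardP card_K by (intro card_subset_eq) auto
  qed
  have "uniquely_resolvable n m k C"
    unfolding uniquely_resolvable_def
  proof
    show "\<forall>j\<in>{1..k}. C j \<noteq> {} \<and> C j \<subseteq> {1..m}" using nonempty unfolding C_def by blast
    show "\<exists>!P. resolution n m k C P" using res uniq by (rule ex1I)
  qed
  then show ?thesis by (auto simp: k_def t_def)
qed

section \<open>Numerical bounds\<close>

lemma max_unique_size_gt:
  assumes "1 \<le> m" "1 \<le> n" "n \<le> 2 ^ (m - 1) - 1"
  shows "real n * (real m + 1) / (log 2 (real n + 1) + 2) < real (max_unique_size n m)"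
proof -
  \<comment> \<open>The block length will be \<open>d + 1\<close>. Minimality of \<open>d\<close>
    gives \<open>2 ^ (d - 1) < n + 1\<close>, the source of the strict inequality.\<close>
  define d where "d = (LEAST d. n + 1 \<le> 2 ^ d)"
  have ex: "n + 1 \<le> 2 ^ (m - 1)"
    using assms(3) le_diff_conv2[of 1 "2 ^ (m - 1)" n] by simp
  have d: "n + 1 \<le> 2 ^ d" unfolding d_def using ex by (rule LeastI)
  have d_le: "d \<le> m - 1" unfolding d_def using ex by (rule Least_le)
  have d0: "d \<noteq> 0"
    using d assms(2) by (intro notI) simp
  have "d - 1 < (LEAST d. n + 1 \<le> 2 ^ d)" using d0 by (fold d_def) simp
  from not_less_Least[OF this] have "\<not> n + 1 \<le> 2 ^ (d - 1)" .
  then have "real (2 ^ (d - 1)) < real (n + 1)" by (simp only: of_nat_less_iff not_le)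
  then have "2 powr real (d - 1) < real n + 1" by (simp add: powr_realpow add.commute)
  then have "real (d - 1) < log 2 (real n + 1)"
    by (subst less_log_iff) auto
  then have s_lt: "real (d + 1) < log 2 (real n + 1) + 2" using d0 by (simp add: of_nat_diff)
  let ?k = "n * (m div (d + 1) + 1)"
  have "m + 1 \<le> (d + 1) * (m div (d + 1) + 1)"
    using dividend_less_times_div[of "d + 1" m] by simp
  then have "real (m + 1) \<le> real ((d + 1) * (m div (d + 1) + 1))" by (simp only: of_nat_le_iff)
  then have le: "real m + 1 \<le> real (d + 1) * real (m div (d + 1) + 1)"
    unfolding of_nat_mult by simp
  have "real n * (real m + 1) / (log 2 (real n + 1) + 2) < real n * (real m + 1) / real (d + 1)"
    using s_lt assms by (intro divide_strict_left_mono) auto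
  also have "\<dots> \<le> real n * real (m div (d + 1) + 1)"
    using mult_left_mono[OF le, of "real n"] by (subst pos_divide_le_eq) (simp_all add: mult_ac)
  also have "\<dots> = real ?k" by (simp only: of_nat_mult)
  also have "\<dots> \<le> real (max_unique_size n m)"
  proof -
    have "\<exists>C. uniquely_resolvable n m ?k C"
      using d d_le d0 assms by (intro uniquely_resolvable_blocks) auto
    then show ?thesis
      unfolding max_unique_size_def of_nat_le_iff
      by (intro Max_ge finite_uniquely_resolvable_sizes CollectI)
  qed
  finally show ?thesis .
qed

text \<open>For \<open>n \<ge> 2\<close> one has \<open>n + 1 \<le> 2 * n\<close> and
  \<open>log 2 n \<ge> 1\<close>, so the denominator is at most
  \<open>log 2 n + 3 \<le> 4 * log 2 n\<close>.\<close>

lemma log_bound_quarter: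
  assumes "2 \<le> n"
  shows "1 / 4 * (real n * real m / log 2 (real n))
           \<le> real n * (real m + 1) / (log 2 (real n + 1) + 2)"
proof -
  have l1: "1 \<le> log 2 (real n)" using assms by (simp add: le_log_iff)
  have "log 2 (real n + 1) \<le> log 2 (2 * real n)" using assms by simp
  also have "\<dots> = 1 + log 2 (real n)" using assms by (simp add: log_mult)
  finally have le: "log 2 (real n + 1) + 2 \<le> 4 * log 2 (real n)" using l1 by simp
  have pos: "0 < log 2 (real n + 1) + 2" using assms by (simp add: add_pos_pos)
  have "1 / 4 * (real n * real m / log 2 (real n)) = real n * real m / (4 * log 2 (real n))"
    by simp
  also have "\<dots> \<le> real n * (real m + 1) / (log 2 (real n + 1) + 2)"
    using le pos by (intro frac_le mult_left_mono) auto
  finally show ?thesis .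
qed

theorem theorem23:
  shows "(\<forall>n m :: nat. 1 \<le> m \<and> 1 \<le> n \<and> n \<le> 2 ^ (m - 1) - 1 \<longrightarrow>
            real (max_unique_size n m) > real n * (real m + 1) / (log 2 (real n + 1) + 2))
       \<and> (\<lambda>(n, m). real (max_unique_size n m))
            \<in> \<Omega>[principal {(n, m). 1 \<le> m \<and> 2 \<le> n \<and> n \<le> 2 ^ (m - 1) - 1}](\<lambda>(n, m). real n * real m / log 2 (real n))"
proof (intro conjI allI impI)
  show "(\<lambda>(n, m). real (max_unique_size n m))
      \<in> \<Omega>[principal {(n, m). 1 \<le> m \<and> 2 \<le> n \<and> n \<le> 2 ^ (m - 1) - 1}](\<lambda>(n, m). real n * real m / log 2 (real n))"
  \<comment> \<open>Over a principal filter the claim is a bound with one constant at every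
    admissible pair.\<close>
  proof (rule landau_omega.bigI[of "1 / 4"], simp, unfold eventually_principal, clarify)
    fix n m :: nat
    assume nm: "1 \<le> m" "2 \<le> n" "n \<le> 2 ^ (m - 1) - 1"
    have "0 \<le> log 2 (real n)" using nm by simp
    then show "norm (real (max_unique_size n m)) \<ge> 1 / 4 * norm (real n * real m / log 2 (real n))"
      using log_bound_quarter[OF nm(2), of m] max_unique_size_gt[of m n] nm by simp
  qed
qed (simp add: max_unique_size_gt)

end
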